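(* Let $\mathbf a=(a_1,\ldots,a_r)$ be a non-empty admissible composition and let $\varepsilon_1\ldots\varepsilon_k=\mathbf w(\mathbf a)$ be its associated binary word. For all $m,n\in\mathbf N$, the iterated integral $$\zeta(\mathbf a)_{m,n}=\int_{1>t_1>\cdots>t_k>0}(1-t_1)^m f_{\varepsilon_1}(t_1)\cdots f_{\varepsilon_k}(t_k)\,t_k^n\,dt_1\cdots dt_k$$ is equal to the sum of the convergent series $$\zeta(\mathbf a)_{m,n}=\sum_{n_1>\cdots>n_r>n}\binom{n_1+m}{m}^{-1}n_1^{-a_1}\cdots n_r^{-a_r},$$ where $n_1,\ldots,n_r$ range over integers.
   Context: $\mathbf N$ denotes the set of non-negative integers. A composition is a finite sequence $\mathbf a=(a_1,\ldots,a_r)$ of positive integers ($r\ge 0$ is its depth, $a_1+\cdots+a_r$ its weight). It is admissible if either $r\ge1$ and $a_1\ge 2$, or $r=0$. A binary word is a finite word over the alphabet $\{0,1\}$; $\{0\}_u$ denotes the word consisting of $u$ letters $0$. The binary word associated to $\mathbf a$ is $\mathbf w(\mathbf a)=\{0\}_{a_1-1}1\{0\}_{a_2-1}1\cdots\{0\}_{a_r-1}1$. Set $f_0(t)=1/t$ and $f_1(t)=1/(1-t)$. *)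

theory Defs
  imports "HOL-Analysis.Analysis"
begin

definition composition :: "nat list \<Rightarrow> bool" where
  "composition a \<longleftrightarrow> (\<forall>x\<in>set a. x > 0)"

definition admissible :: "nat list \<Rightarrow> bool" where
  "admissible a \<longleftrightarrow> composition a \<and> (a = [] \<or> hd a \<ge> 2)"

datatype letter = L0 | L1

definition binary_word :: "nat list \<Rightarrow> letter list" where
  "binary_word a = concat (map (\<lambda>x. replicate (x - 1) L0 @ [L1]) a)"

fun letter_fun :: "letter \<Rightarrow> real \<Rightarrow> real" where
  "letter_fun L0 t = 1 / t"
| "letter_fun L1 t = 1 / (1 - t)"

text \<open>
  Points of $k$-dimensional space are functions on the index set \<open>{..<k}\<close>, so the coordinate
  $t_{i+1}$ is \<open>t i\<close>, and Lebesgue measure is the product of \<open>k\<close> copies of \<open>lborel\<close>.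
\<close>

definition lborel_pow :: "nat \<Rightarrow> (nat \<Rightarrow> real) measure" where
  "lborel_pow k = (\<Pi>\<^sub>M i\<in>{..<k}. lborel)"

definition open_simplex :: "nat \<Rightarrow> (nat \<Rightarrow> real) set" where
  "open_simplex k = {t \<in> space (lborel_pow k). sorted_wrt (>) (1 # map t [0..<k] @ [0])}"

definition zeta_integrand :: "letter list \<Rightarrow> nat \<Rightarrow> nat \<Rightarrow> (nat \<Rightarrow> real) \<Rightarrow> real" where
  "zeta_integrand w m n t =
     (1 - t 0) ^ m * (\<Prod>i<length w. letter_fun (w ! i) (t i)) * t (length w - 1) ^ n"

definition zeta_integral :: "nat list \<Rightarrow> nat \<Rightarrow> nat \<Rightarrow> real" where
  "zeta_integral a m n =
     (let w = binary_word a; k = length w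
      in LINT t:open_simplex k|lborel_pow k. zeta_integrand w m n t)"

text \<open>
  The tuples $n_1 > \cdots > n_r > n$. As $n \ge 0$, ranging over naturals is the same as ranging
  over integers.
\<close>

definition zeta_indices :: "nat \<Rightarrow> nat \<Rightarrow> nat list set" where
  "zeta_indices r n = {ns. length ns = r \<and> sorted_wrt (>) (ns @ [n])}"

definition zeta_term :: "nat list \<Rightarrow> nat \<Rightarrow> nat list \<Rightarrow> real" where
  "zeta_term a m ns =
     inverse (real ((hd ns + m) choose m)) * (\<Prod>i<length a. inverse (real (ns ! i) ^ (a ! i)))"

end

theory Submission imports Defs
begin

text \<open>
  Integrate the variables from the innermost one outwards. As a function of its upper endpoint
  \<open>x < 1\<close>, the integral over $x > t_i > \cdots > t_k > 0$ is a power series with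
  nonnegative coefficients: multiplying $\sum c_j x^j$ by $f_0$ and integrating replaces $c_j$ by
  $c_j / j$, while $f_1$ replaces it by $(c_0 + \cdots + c_{j-1}) / j$. Unrolling this recursion gives
  the nested sums. Since the word of an admissible composition starts with $0$, the outermost
  integration is $\int_0^1 (1-t)^m t^{j-1} dt = 1 / (j \binom{j+m}{m})$ termwise. Everything is
  nonnegative, so sums and integrals commute freely; finiteness follows at the end from the bound
  $c_j = O(j^{-1/2})$, which both steps of the recursion preserve.
\<close>

section \<open>Taylor coefficients\<close>

text \<open>
  The base case is the factor $x^n$. Division by zero makes the coefficient of index \<open>0\<close>
  vanish for every nonempty word.
\<close>

fun word_coeff :: "nat \<Rightarrow> letter list \<Rightarrow> nat \<Rightarrow> real" where
  "word_coeff n [] j = (if j = n then 1 else 0)"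
| "word_coeff n (L0 # w) j = word_coeff n w j / real j"
| "word_coeff n (L1 # w) j = (\<Sum>i<j. word_coeff n w i) / real j"

lemma word_coeff_nonneg: "0 \<le> word_coeff n w j"
  by (induction n w j rule: word_coeff.induct) (auto intro!: divide_nonneg_nonneg sum_nonneg)

lemma word_coeff_0: "w \<noteq> [] \<Longrightarrow> word_coeff n w 0 = 0"
  by (cases w; cases "hd w") auto

section \<open>Growth of the coefficients and summability\<close>

lemma sum_inverse_sqrt_le: "(\<Sum>i<p. 1 / sqrt (real i + 1)) \<le> 2 * sqrt (real p)"
proof (induction p)
  case (Suc p)
  \<comment> \<open>The sum telescopes against 2 (b - a): from (b - a)(b + a) = 1 and b + a <= 2 b
    follows 1 / b <= 2 (b - a).\<close>
  define a b where "a = sqrt (real p)" and "b = sqrt (real p + 1)"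
  have ab: "0 \<le> a" "0 < b" "a \<le> b" "b * b - a * a = 1"
    by (auto simp: a_def b_def)
  have "1 = (b - a) * (b + a)" using ab by (simp add: algebra_simps)
  also have "\<dots> \<le> (b - a) * (2 * b)" using ab by (intro mult_left_mono) auto
  finally have "1 / b \<le> 2 * (b - a)" using ab by (simp add: field_simps)
  with Suc show ?case by (simp add: a_def b_def add.commute)
qed auto

text \<open>Any decay j^(-s) with 0 < s < 1 would survive both steps: dividing by j >= 1 only helps,
  and averaging costs a constant factor, whereas s = 1 would gain a logarithm. A positive s is what
  makes one further division by j summable.\<close>

lemma word_coeff_bound: "\<exists>C\<ge>0. \<forall>j. word_coeff n w j \<le> C / sqrt (real j + 1)"
proof (induction w)
  case Nil
  \<comment> \<open>The only nonzero coefficient is 1 at \<open>j = n\<close>, where this constant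
    gives equality.\<close>
  show ?case by (intro exI[of _ "sqrt (real n + 1)"]) auto
next
  case (Cons e w)
  then obtain C where C: "C \<ge> 0" "\<And>j. word_coeff n w j \<le> C / sqrt (real j + 1)" by blast
  show ?case
  proof (cases e)
    case L0
    have "word_coeff n w j / real j \<le> C / sqrt (real j + 1)" for j
    proof (cases "j = 0")
      case False
      then have "word_coeff n w j / real j \<le> word_coeff n w j / 1"
        by (intro divide_left_mono) (auto simp: word_coeff_nonneg)
      then show ?thesis using C(2)[of j] by simp
    qed (use C in auto)
    then show ?thesis using C(1) L0 by auto
  next
    case L1
    \<comment> \<open>One factor 2 comes from the sum of inverse square roots, the other from
      replacing \<open>sqrt j\<close> by \<open>sqrt (j + 1)\<close>, using j + 1 <= 4 j.\<close>
    have "(\<Sum>i<j. word_coeff n w i) / real j \<le> 4 * C / sqrt (real j + 1)" for j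
    proof (cases "j = 0")
      case False
      have "(\<Sum>i<j. word_coeff n w i) \<le> (\<Sum>i<j. C * (1 / sqrt (real i + 1)))"
        using C(2) by (intro sum_mono) simp
      also have "\<dots> \<le> C * (2 * sqrt (real j))"
        unfolding sum_distrib_left[symmetric] by (intro mult_left_mono sum_inverse_sqrt_le C)
      finally have "(\<Sum>i<j. word_coeff n w i) / real j \<le> C * (2 * sqrt (real j)) / real j"
        by (intro divide_right_mono) auto
      also have "\<dots> = 2 * C / sqrt (real j)"
        using False by (simp add: field_simps flip: power2_eq_square)
      also have "\<dots> \<le> 4 * C / sqrt (real j + 1)"
      proof -
        have "sqrt (real j + 1) \<le> sqrt (4 * real j)" using False by (intro real_sqrt_le_mono) simp
        also have "\<dots> = 2 * sqrt (real j)" by (simp add: real_sqrt_mult)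
        finally have "2 * C * sqrt (real j + 1) \<le> 2 * C * (2 * sqrt (real j))"
          using C(1) by (intro mult_left_mono) auto
        then show ?thesis using False by (simp add: field_simps add_pos_pos)
      qed
      finally show ?thesis .
    qed (use C in auto)
    then show ?thesis using C(1) L1 by (intro exI[of _ "4 * C"]) auto
  qed
qed

text \<open>The leading \<open>L0\<close> supplies one more division by j, hence decay j^(-3/2).
  This is where admissibility secures convergence at the endpoint 1.\<close>

lemma summable_word_coeff_L0: "summable (word_coeff n (L0 # w))"
proof -
  obtain C where C: "C \<ge> 0" "\<And>j. word_coeff n w j \<le> C / sqrt (real j + 1)"
    using word_coeff_bound by blast
  have "summable (\<lambda>j. C * real j powr (-3/2))"
    by (intro summable_mult) (simp add: summable_real_powr_iff)
  then show ?thesis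
  proof (rule summable_comparison_test'[where N = 1])
    fix j :: nat assume j: "1 \<le> j"
    have "word_coeff n w j \<le> C / sqrt (real j + 1)" by (rule C)
    also have "\<dots> \<le> C / sqrt (real j)"
      using j C by (intro divide_left_mono) auto
    finally have "word_coeff n w j / real j \<le> C / sqrt (real j) / real j"
      by (intro divide_right_mono) auto
    also have "\<dots> = C * real j powr (-3/2)"
    proof -
      have "real j powr (-3/2) = real j powr (- (1/2) + -1)" by simp
      also have "\<dots> = real j powr (- (1/2)) * real j powr (-1)" by (rule powr_add)
      also have "\<dots> = 1 / (sqrt (real j) * real j)"
        using j by (simp add: powr_minus powr_half_sqrt field_simps)
      finally show ?thesis by simp
    qed
    finally show "norm (word_coeff n (L0 # w) j) \<le> C * real j powr (-3/2)"
      using word_coeff_nonneg[of n "L0 # w" j] by simp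
  qed
qed

lemma summable_word_coeff_power:
  assumes "0 \<le> x" "x < 1"
  shows "summable (\<lambda>j. word_coeff n w j * x ^ j)"
proof -
  obtain C where C: "C \<ge> 0" "\<And>j. word_coeff n w j \<le> C / sqrt (real j + 1)"
    using word_coeff_bound by blast
  have le: "word_coeff n w j \<le> C" for j
  proof -
    have "C / sqrt (real j + 1) \<le> C / 1" using C by (intro divide_left_mono) auto
    then show ?thesis using C(2)[of j] by simp
  qed
  have "summable (\<lambda>j. C * x ^ j)" using assms by (intro summable_mult summable_geometric) auto
  then show ?thesis
    by (rule summable_comparison_test'[where N = 0])
       (use assms le in \<open>auto simp: abs_mult word_coeff_nonneg intro!: mult_right_mono\<close>)
qed

section \<open>Coefficients as nested sums\<close>

text \<open>Tuples grouped by their head. Appending \<open>n\<close> gives the empty tuple the head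
  \<open>n\<close>, in agreement with the base coefficients, which are concentrated at
  \<open>j = n\<close>.\<close>

definition zeta_fiber :: "nat \<Rightarrow> nat \<Rightarrow> nat \<Rightarrow> nat list set" where
  "zeta_fiber r n j = {ns \<in> zeta_indices r n. hd (ns @ [n]) = j}"

lemma zeta_fiber_0: "zeta_fiber 0 n j = (if j = n then {[]} else {})"
  by (auto simp: zeta_fiber_def zeta_indices_def)

lemma sorted_wrt_greater_Cons_Cons:
  "sorted_wrt (>) (x # y # zs) \<longleftrightarrow> y < x \<and> sorted_wrt (>) (y # zs)" for x y :: "'a::linorder"
  by auto

text \<open>Removing the head \<open>j\<close> leaves a tuple with head below \<open>j\<close>; for
  the empty tuple, the default head turns this into the last inequality
  \<open>n < j\<close>.\<close>

lemma zeta_fiber_Suc: "zeta_fiber (Suc r) n j = (#) j ` (\<Union>i<j. zeta_fiber r n i)"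
proof -
  have "j # ns \<in> zeta_indices (Suc r) n \<longleftrightarrow> ns \<in> zeta_indices r n \<and> hd (ns @ [n]) < j" for ns
    by (cases ns) (auto simp: zeta_indices_def)
  moreover have "\<exists>ns'. ns = j # ns'" if "ns \<in> zeta_fiber (Suc r) n j" for ns
    using that by (cases ns) (auto simp: zeta_fiber_def zeta_indices_def)
  ultimately have "ns \<in> zeta_fiber (Suc r) n j \<longleftrightarrow>
      (\<exists>ns'. ns = j # ns' \<and> ns' \<in> zeta_indices r n \<and> hd (ns' @ [n]) < j)" for ns
    unfolding zeta_fiber_def by fastforce
  then show ?thesis unfolding zeta_fiber_def by blast
qed

lemma finite_zeta_fiber: "finite (zeta_fiber r n j)"
  by (induction r arbitrary: j) (auto simp: zeta_fiber_0 zeta_fiber_Suc)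

lemma word_coeff_replicate_L0: "word_coeff n (replicate k L0 @ w) j = word_coeff n w j / real j ^ k"
  by (induction k) auto

text \<open>A block of x - 1 zeros and a one acts as a single summation: \<open>L1\<close> sums over
  all smaller heads and divides by j once, and the zeros supply the remaining x - 1
  divisions.\<close>

lemma word_coeff_binary_word:
  assumes "composition a"
  shows "word_coeff n (binary_word a) j =
    (\<Sum>ns\<in>zeta_fiber (length a) n j. \<Prod>i<length a. inverse (real (ns ! i) ^ (a ! i)))"
  using assms
proof (induction a arbitrary: j)
  case Nil
  then show ?case by (simp add: binary_word_def zeta_fiber_0)
next
  case (Cons x a)
  define T where "T ns = (\<Prod>i<length a. inverse (real (ns ! i) ^ (a ! i)))" for ns
  have x: "x > 0" and a: "composition a" using Cons.prems by (auto simp: composition_def)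
  have "word_coeff n (binary_word (x # a)) j =
      word_coeff n (replicate (x - 1) L0 @ L1 # binary_word a) j"
    by (simp add: binary_word_def)
  also have "\<dots> = (\<Sum>i<j. word_coeff n (binary_word a) i) / real j ^ x"
    using x by (cases x) (simp_all add: word_coeff_replicate_L0)
  also have "(\<Sum>i<j. word_coeff n (binary_word a) i) = (\<Sum>i<j. \<Sum>ns\<in>zeta_fiber (length a) n i. T ns)"
    using Cons.IH[OF a] by (simp add: T_def)
  also have "\<dots> = (\<Sum>ns\<in>(\<Union>i<j. zeta_fiber (length a) n i). T ns)"
    by (intro sum.UNION_disjoint[symmetric])
       (auto simp: finite_zeta_fiber, auto simp: zeta_fiber_def)
  also have "\<dots> / real j ^ x =
      (\<Sum>ns\<in>(\<Union>i<j. zeta_fiber (length a) n i). inverse (real j ^ x) * T ns)"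
    by (simp add: sum_distrib_left divide_inverse mult.commute)
  also have "\<dots> = (\<Sum>ns\<in>(\<Union>i<j. zeta_fiber (length a) n i).
      \<Prod>i<length (x # a). inverse (real ((j # ns) ! i) ^ ((x # a) ! i)))"
    by (simp add: T_def prod.lessThan_Suc_shift del: prod.lessThan_Suc)
  also have "\<dots> = (\<Sum>ns\<in>zeta_fiber (length (x # a)) n j.
      \<Prod>i<length (x # a). inverse (real (ns ! i) ^ ((x # a) ! i)))"
    unfolding length_Cons zeta_fiber_Suc by (subst sum.reindex) auto
  finally show ?case .
qed

lemma zeta_term_nonneg: "0 \<le> zeta_term a m ns"
  by (auto simp: zeta_term_def intro!: mult_nonneg_nonneg prod_nonneg)

text \<open>The binomial weight depends on the head alone, so each fiber contributes one term of the
  series. All terms are nonnegative, so the finite fiber sums may be merged into one unordered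
  sum.\<close>

lemma has_sum_zeta_term:
  assumes "composition a" "a \<noteq> []"
    and "(\<lambda>j. inverse (real ((j + m) choose m)) * word_coeff n (binary_word a) j) sums S"
  shows "(zeta_term a m has_sum S) (zeta_indices (length a) n)"
proof -
  define g where "g j = inverse (real ((j + m) choose m)) * word_coeff n (binary_word a) j" for j
  have fiber: "(zeta_term a m has_sum g j) (zeta_fiber (length a) n j)" for j
  proof -
    have "zeta_term a m ns = inverse (real ((j + m) choose m)) *
        (\<Prod>i<length a. inverse (real (ns ! i) ^ (a ! i)))" if "ns \<in> zeta_fiber (length a) n j" for ns
      using that assms(2) by (cases ns) (auto simp: zeta_fiber_def zeta_indices_def zeta_term_def)
    then have "sum (zeta_term a m) (zeta_fiber (length a) n j) = g j"
      by (simp add: g_def word_coeff_binary_word[OF assms(1)] sum_distrib_left)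
    then show ?thesis using has_sum_finite[OF finite_zeta_fiber] by metis
  qed
  have g: "(g has_sum S) UNIV"
    using assms(3) unfolding g_def
    by (rule sums_nonneg_imp_has_sum) (auto simp: word_coeff_nonneg)
  have "(zeta_term a m \<circ> snd has_sum S) (Sigma UNIV (zeta_fiber (length a) n))"
  proof (rule has_sum_SigmaI)
    show "zeta_term a m \<circ> snd summable_on Sigma UNIV (zeta_fiber (length a) n)"
    proof (rule summable_on_SigmaI)
      show "g summable_on UNIV" using g by (rule has_sum_imp_summable)
    qed (use fiber in \<open>auto simp: o_def zeta_term_nonneg\<close>)
  qed (use fiber g in \<open>auto simp: o_def\<close>)
  moreover have "inj_on snd (Sigma UNIV (zeta_fiber (length a) n))"
    by (auto simp: inj_on_def zeta_fiber_def)
  moreover have "snd ` (Sigma UNIV (zeta_fiber (length a) n)) = zeta_indices (length a) n"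
    by (force simp: zeta_fiber_def)
  ultimately show ?thesis using has_sum_reindex by metis
qed

section \<open>Integrals of power series\<close>

lemma has_integral_power_Ioo:
  assumes "0 \<le> x"
  shows "((\<lambda>y. y ^ q) has_integral x ^ Suc q / real (Suc q)) {0<..<x::real}"
proof -
  have "((\<lambda>y. y ^ Suc q / real (Suc q)) has_real_derivative y ^ q) (at y within {0..x})" for y
    using DERIV_cdivide[OF DERIV_power_Suc[OF DERIV_ident], of q "real (Suc q)" y "{0..x}"]
    by (simp del: of_nat_Suc add: of_nat_Suc[symmetric])
  then have "((\<lambda>y. y ^ q) has_integral (x ^ Suc q / real (Suc q) - 0 ^ Suc q / real (Suc q))) {0..x}"
    using assms
    by (intro fundamental_theorem_of_calculus)
       (auto simp flip: has_real_derivative_iff_has_vector_derivative)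
  then show ?thesis by (simp add: has_integral_Icc_iff_Ioo)
qed

text \<open>Euler's beta integral B(m + 1, q + 1), in the form that shows the weight of the series
  at j = q + 1. Integration by parts trades a power of 1 - y for a power of y, so the induction on
  \<open>m\<close> must cover every \<open>q\<close>.\<close>

lemma has_integral_beta_nat:
  "((\<lambda>y. (1 - y) ^ m * y ^ q) has_integral
     1 / (real (Suc q) * real ((Suc q + m) choose m))) {0<..<1::real}"
proof (induction m arbitrary: q)
  case 0
  show ?case using has_integral_power_Ioo[of 1 q] by simp
next
  case (Suc m)
  \<comment> \<open>The boundary term of the integration by parts; it vanishes at both 0 and
    1.\<close>
  define F where "F y = (1 - y) ^ Suc m * y ^ Suc q / real (Suc q)" for y :: real
  have "(F has_real_derivative
      (1 - y) ^ Suc m * y ^ q - real (Suc m) / real (Suc q) * ((1 - y) ^ m * y ^ Suc q))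
      (at y within {0..1})" for y
  proof -
    have "((\<lambda>y. (1 - y) ^ Suc m * y ^ Suc q) has_real_derivative
        - (real (Suc m) * (1 - y) ^ m) * y ^ Suc q + real (Suc q) * y ^ q * (1 - y) ^ Suc m)
        (at y within {0..1})"
      using DERIV_mult[OF DERIV_power_Suc[OF DERIV_diff[OF DERIV_const[of 1] DERIV_ident], of m]
          DERIV_power_Suc[OF DERIV_ident, of q], of y "{0..1}"]
      by (simp add: mult_ac)
    from DERIV_cdivide[OF this, of "real (Suc q)"] show ?thesis
      unfolding F_def by (simp add: add_divide_distrib diff_divide_distrib mult_ac del: of_nat_Suc power_Suc)
  qed
  then have "((\<lambda>y. (1 - y) ^ Suc m * y ^ q - real (Suc m) / real (Suc q) * ((1 - y) ^ m * y ^ Suc q))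
      has_integral (F 1 - F 0)) {0..1}"
    by (intro fundamental_theorem_of_calculus)
       (auto simp flip: has_real_derivative_iff_has_vector_derivative)
  then have "((\<lambda>y. (1 - y) ^ Suc m * y ^ q - real (Suc m) / real (Suc q) * ((1 - y) ^ m * y ^ Suc q))
      has_integral 0) {0<..<1}"
    by (simp add: has_integral_Icc_iff_Ioo F_def)
  from has_integral_add[OF this has_integral_mult_right[OF Suc.IH[of "Suc q"], of "real (Suc m) / real (Suc q)"]]
  have "((\<lambda>y. (1 - y) ^ Suc m * y ^ q) has_integral
      real (Suc m) / real (Suc q) * (1 / (real (Suc (Suc q)) * real ((Suc (Suc q) + m) choose m)))) {0<..<1}"
    by simp
  moreover have "real (Suc (Suc q)) * real ((Suc (Suc q) + m) choose m) =
      real (Suc m) * real ((Suc q + Suc m) choose Suc m)"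
  proof -
    \<comment> \<open>With N = q + m + 2, both sides equal N times the binomial coefficient of N - 1
      over m.\<close>
    have "Suc m * ((Suc q + Suc m) choose Suc m) = Suc (Suc q) * ((Suc (Suc q) + m) choose m)"
      using binomial_absorption[of m "Suc q + Suc m"] binomial_absorb_comp[of "Suc q + Suc m" m]
      by (simp del: binomial_Suc_Suc)
    then show ?thesis by (simp del: binomial_Suc_Suc of_nat_Suc flip: of_nat_mult)
  qed
  ultimately show ?case by simp
qed

text \<open>Termwise integration by monotone convergence, valid even if the series diverges. The
  weight \<open>h\<close> is 1 for the inner variables and (1 - y)^m for the outermost one;
  \<open>I\<close> lists its moments.\<close>

lemma nn_integral_power_series:
  fixes h :: "real \<Rightarrow> real" and d :: "nat \<Rightarrow> real"
  assumes [measurable]: "h \<in> borel_measurable borel"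
    and d: "\<And>q. 0 \<le> d q" and h: "\<And>y. 0 < y \<Longrightarrow> y < x \<Longrightarrow> 0 \<le> h y"
    and I: "\<And>q. ((\<lambda>y. h y * y ^ q) has_integral I q) {0<..<x}"
  shows "(\<integral>\<^sup>+y. indicator {0<..<x} y * (ennreal (h y) * (\<Sum>q. ennreal (d q * y ^ q))) \<partial>lborel) =
    (\<Sum>q. ennreal (d q * I q))"
proof -
  have "(\<integral>\<^sup>+y. indicator {0<..<x} y * (ennreal (h y) * (\<Sum>q. ennreal (d q * y ^ q))) \<partial>lborel) =
      (\<integral>\<^sup>+y. (\<Sum>q. ennreal (d q * (h y * y ^ q)) * indicator {0<..<x} y) \<partial>lborel)"
  proof (rule nn_integral_cong)
    fix y :: real
    have "ennreal (h y) * ennreal (d q * y ^ q) = ennreal (d q * (h y * y ^ q))" if "y \<in> {0<..<x}" for q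
      using that h d by (simp add: mult_ac flip: ennreal_mult)
    then show "indicator {0<..<x} y * (ennreal (h y) * (\<Sum>q. ennreal (d q * y ^ q))) =
        (\<Sum>q. ennreal (d q * (h y * y ^ q)) * indicator {0<..<x} y)"
      by (cases "y \<in> {0<..<x}") (auto simp flip: ennreal_suminf_cmult)
  qed
  also have "\<dots> = (\<Sum>q. \<integral>\<^sup>+y. ennreal (d q * (h y * y ^ q)) * indicator {0<..<x} y \<partial>lborel)"
    by (rule nn_integral_suminf) measurable
  also have "\<dots> = (\<Sum>q. ennreal (d q * I q))"
    using h d
    by (intro suminf_cong nn_integral_has_integral_lebesgue' has_integral_mult_right I) auto
  finally show ?thesis .
qed

section \<open>Multiplication of a power series by a letter\<close>

lemma suminf_ennreal_shift:
  fixes f :: "nat \<Rightarrow> ennreal"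
  assumes "f 0 = 0"
  shows "(\<Sum>q. f (Suc q)) = (\<Sum>j. f j)"
  using assms suminf_offset[of f 1] by (simp add: summableI)

text \<open>The Cauchy product with the geometric series turns coefficients into partial sums. The
  one at \<open>q\<close> is \<open>Suc q\<close> times the coefficient of \<open>L1 # w\<close> at
  \<open>Suc q\<close>.\<close>

lemma letter_L1_power_series:
  assumes y: "0 < y" "y < 1"
  shows "ennreal (letter_fun L1 y) * (\<Sum>j. ennreal (word_coeff n w j * y ^ j)) =
    (\<Sum>q. ennreal ((\<Sum>j<Suc q. word_coeff n w j) * y ^ q))"
proof -
  let ?a = "\<lambda>j. word_coeff n w j * y ^ j"
  have nn: "0 \<le> ?a j" for j using y by (simp add: word_coeff_nonneg)
  have sm: "summable ?a" using y by (intro summable_word_coeff_power) auto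
  have "(\<lambda>k. \<Sum>i\<le>k. ?a i * y ^ (k - i)) sums ((\<Sum>k. ?a k) * (\<Sum>k. y ^ k))"
    using sm nn y by (intro Cauchy_product_sums) (auto simp: summable_geometric)
  moreover have "(\<Sum>i\<le>k. ?a i * y ^ (k - i)) = (\<Sum>j<Suc k. word_coeff n w j) * y ^ k" for k
    unfolding lessThan_Suc_atMost sum_distrib_right
    by (intro sum.cong) (auto simp: mult.assoc simp flip: power_add)
  moreover have "(\<Sum>k. y ^ k) = letter_fun L1 y" using y by (simp add: suminf_geometric)
  ultimately have "(\<lambda>q. (\<Sum>j<Suc q. word_coeff n w j) * y ^ q) sums (letter_fun L1 y * (\<Sum>k. ?a k))"
    by (simp add: mult.commute)
  then have "(\<Sum>q. ennreal ((\<Sum>j<Suc q. word_coeff n w j) * y ^ q)) =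
      ennreal (letter_fun L1 y * (\<Sum>k. ?a k))"
    using y by (intro suminf_ennreal_eq) (auto intro!: mult_nonneg_nonneg sum_nonneg add_nonneg_nonneg simp: word_coeff_nonneg)
  also have "\<dots> = ennreal (letter_fun L1 y) * ennreal (\<Sum>k. ?a k)"
    using y by (intro ennreal_mult') auto
  also have "ennreal (\<Sum>k. ?a k) = (\<Sum>k. ennreal (?a k))"
    using nn sm by (rule suminf_ennreal2[symmetric])
  finally show ?thesis by (rule sym)
qed

text \<open>Dividing by y leaves a power series because a nonempty word has constant coefficient
  zero.\<close>

lemma letter_L0_power_series:
  assumes y: "0 < y" and "w \<noteq> []"
  shows "ennreal (letter_fun L0 y) * (\<Sum>j. ennreal (word_coeff n w j * y ^ j)) =
    (\<Sum>q. ennreal (word_coeff n w (Suc q) * y ^ q))"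
proof -
  have "ennreal (letter_fun L0 y) * (\<Sum>j. ennreal (word_coeff n w j * y ^ j)) =
      ennreal (letter_fun L0 y) * (\<Sum>q. ennreal (word_coeff n w (Suc q) * y ^ Suc q))"
    using word_coeff_0[OF assms(2)] by (subst suminf_ennreal_shift) auto
  also have "\<dots> = (\<Sum>q. ennreal (letter_fun L0 y) * ennreal (word_coeff n w (Suc q) * y ^ Suc q))"
    by simp
  also have "\<dots> = (\<Sum>q. ennreal (word_coeff n w (Suc q) * y ^ q))"
    using y by (intro suminf_cong) (simp flip: ennreal_mult add: word_coeff_nonneg)
  finally show ?thesis .
qed

section \<open>Integration over the simplex\<close>

text \<open>
  The integrand of the letters \<open>w\<close> in the variables \<open>t i, t (i + 1), \<dots>\<close>, extended by
  zero outside $x > t_i > t_{i+1} > \cdots > 0$.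
\<close>

fun nested_integrand :: "nat \<Rightarrow> letter list \<Rightarrow> nat \<Rightarrow> real \<Rightarrow> (nat \<Rightarrow> real) \<Rightarrow> ennreal" where
  "nested_integrand n [] i x t = indicator {0<..} x * ennreal (x ^ n)"
| "nested_integrand n (e # w) i x t =
     indicator {..<x} (t i) * ennreal (letter_fun e (t i)) * nested_integrand n w (Suc i) (t i) t"

lemma measurable_letter_fun [measurable]: "letter_fun e \<in> borel_measurable borel"
proof (cases e)
  case L0
  then have "letter_fun e = (\<lambda>t. 1 / t)" by auto
  then show ?thesis by simp
next
  case L1
  then have "letter_fun e = (\<lambda>t. 1 / (1 - t))" by auto
  then show ?thesis by simp
qed

text \<open>The upper endpoint \<open>X\<close> may depend on the point, since in the recursion it
  becomes the coordinate \<open>t i\<close>.\<close>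

lemma measurable_nested_integrand:
  assumes "X \<in> borel_measurable (Pi\<^sub>M J (\<lambda>_. lborel))" "{i..<i + length w} \<subseteq> J"
  shows "(\<lambda>t. nested_integrand n w i (X t) t) \<in> borel_measurable (Pi\<^sub>M J (\<lambda>_. lborel))"
  using assms
proof (induction w arbitrary: i X)
  case Nil
  note [measurable] = Nil.prems(1)
  show ?case by simp
next
  case (Cons e w)
  note [measurable] = Cons.prems(1)
  have i: "i \<in> J" using Cons.prems(2) by auto
  have ti [measurable]: "(\<lambda>t. t i) \<in> borel_measurable (Pi\<^sub>M J (\<lambda>_. lborel :: real measure))"
    using measurable_component_singleton[OF i, of "\<lambda>_. lborel :: real measure"] by simp
  have [measurable]: "(\<lambda>t. nested_integrand n w (Suc i) (t i) t) \<in> borel_measurable (Pi\<^sub>M J (\<lambda>_. lborel))"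
    using Cons.prems(2) by (intro Cons.IH ti) auto
  have "indicator {..<X t} (t i) = (if t i < X t then 1 else 0 :: ennreal)" for t by auto
  then show ?case by simp
qed

text \<open>Positivity is tested at the innermost variable only; it propagates outwards because each
  variable lies below the preceding one.\<close>

lemma nested_integrand_nonpos: "x \<le> 0 \<Longrightarrow> nested_integrand n w i x t = 0"
  by (induction w arbitrary: i x) (auto simp: indicator_def)

lemma nested_integrand_fun_upd:
  "j < i \<Longrightarrow> nested_integrand n w i x (t(j := y)) = nested_integrand n w i x t"
  by (induction w arbitrary: i x) auto

text \<open>Unrolls the recursion to reach the chain of inequalities in \<open>open_simplex\<close>.
  Prepending \<open>x\<close> makes \<open>last\<close> meaningful for the empty word, where the
  base factor is x^n.\<close>

lemma nested_integrand_eq: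
  "nested_integrand n w i x t =
    (if sorted_wrt (>) (x # map t [i..<i + length w] @ [0])
     then (\<Prod>l<length w. ennreal (letter_fun (w ! l) (t (i + l)))) *
       ennreal (last (x # map t [i..<i + length w]) ^ n) else 0)"
proof (induction w arbitrary: i x)
  case (Cons e w)
  have *: "[i..<i + length (e # w)] = i # [Suc i..<Suc i + length w]"
    by (subst upt_conv_Cons) auto
  define Q where "Q \<longleftrightarrow> sorted_wrt (>) (t i # map t [Suc i..<Suc i + length w] @ [0])"
  define L where "L = last (t i # map t [Suc i..<Suc i + length w])"
  have "sorted_wrt (>) (x # map t [i..<i + length (e # w)] @ [0]) \<longleftrightarrow> t i < x \<and> Q"
    unfolding Q_def * list.map append_Cons by (rule sorted_wrt_greater_Cons_Cons)
  moreover have "last (x # map t [i..<i + length (e # w)]) = L"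
    unfolding L_def * by simp
  moreover have "(\<Prod>l<length (e # w). ennreal (letter_fun ((e # w) ! l) (t (i + l)))) =
      ennreal (letter_fun e (t i)) * (\<Prod>l<length w. ennreal (letter_fun (w ! l) (t (Suc i + l))))"
    by (simp add: prod.lessThan_Suc_shift del: prod.lessThan_Suc)
  moreover have "nested_integrand n w (Suc i) (t i) t =
      (if Q then (\<Prod>l<length w. ennreal (letter_fun (w ! l) (t (Suc i + l)))) * ennreal (L ^ n) else 0)"
    unfolding Cons.IH Q_def L_def ..
  ultimately show ?case
    by (simp only: nested_integrand.simps) (simp add: mult.assoc)
qed auto

lemma nn_integral_lborel_PiM_split:
  assumes "f \<in> borel_measurable (Pi\<^sub>M {i..<Suc (i + k)} (\<lambda>_. lborel))"
  shows "(\<integral>\<^sup>+t. f t \<partial>Pi\<^sub>M {i..<Suc (i + k)} (\<lambda>_. lborel)) =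
    (\<integral>\<^sup>+y. \<integral>\<^sup>+t. f (t(i := y)) \<partial>Pi\<^sub>M {Suc i..<Suc i + k} (\<lambda>_. lborel) \<partial>(lborel :: real measure))"
proof -
  interpret product_sigma_finite "\<lambda>_::nat. lborel :: real measure" by standard
  have "{i..<Suc (i + k)} = insert i {Suc i..<Suc i + k}" by auto
  then show ?thesis
    using assms by (simp only:) (intro product_nn_integral_insert_rev, auto)
qed

abbreviation nested_integral :: "nat \<Rightarrow> letter list \<Rightarrow> nat \<Rightarrow> real \<Rightarrow> ennreal" where
  "nested_integral n w i x \<equiv>
     \<integral>\<^sup>+t. nested_integrand n w i x t \<partial>Pi\<^sub>M {i..<i + length w} (\<lambda>_. lborel)"

text \<open>Tonelli for the outermost variable. The weight \<open>h\<close> involves this variable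
  alone, so the inner integral is unaffected by it.\<close>

lemma nn_integral_weighted_nested_Cons:
  assumes [measurable]: "h \<in> borel_measurable borel"
  shows "(\<integral>\<^sup>+t. ennreal (h (t i)) * nested_integrand n (e # w) i x t
        \<partial>Pi\<^sub>M {i..<Suc (i + length w)} (\<lambda>_. lborel)) =
    (\<integral>\<^sup>+y. indicator {0<..<x} y * (ennreal (h y) * (ennreal (letter_fun e y) * nested_integral n w (Suc i) y))
        \<partial>lborel)"
proof -
  let ?J = "{i..<Suc (i + length w)}"
  have ti [measurable]: "(\<lambda>t. t i) \<in> borel_measurable (Pi\<^sub>M ?J (\<lambda>_. lborel :: real measure))"
    using measurable_component_singleton[of i ?J "\<lambda>_. lborel :: real measure"] by simp
  have [measurable]: "nested_integrand n (e # w) i x \<in> borel_measurable (Pi\<^sub>M ?J (\<lambda>_. lborel))"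
    by (rule measurable_nested_integrand) auto
  have meas: "(\<lambda>t. ennreal (h (t i)) * nested_integrand n (e # w) i x t)
      \<in> borel_measurable (Pi\<^sub>M ?J (\<lambda>_. lborel))"
    by measurable
  have "(\<integral>\<^sup>+t. ennreal (h (t i)) * nested_integrand n (e # w) i x t \<partial>Pi\<^sub>M ?J (\<lambda>_. lborel)) =
      (\<integral>\<^sup>+y. \<integral>\<^sup>+t. indicator {..<x} y * (ennreal (h y) * ennreal (letter_fun e y)) *
        nested_integrand n w (Suc i) y t \<partial>Pi\<^sub>M {Suc i..<Suc i + length w} (\<lambda>_. lborel) \<partial>lborel)"
    unfolding nn_integral_lborel_PiM_split[OF meas]
    by (simp add: nested_integrand_fun_upd mult_ac)
  also have "\<dots> = (\<integral>\<^sup>+y. indicator {0<..<x} y * (ennreal (h y) *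
      (ennreal (letter_fun e y) * nested_integral n w (Suc i) y)) \<partial>lborel)"
  proof (rule nn_integral_cong)
    fix y :: real
    have [measurable]: "nested_integrand n w (Suc i) y \<in>
        borel_measurable (Pi\<^sub>M {Suc i..<Suc i + length w} (\<lambda>_. lborel))"
      by (rule measurable_nested_integrand) auto
    show "(\<integral>\<^sup>+t. indicator {..<x} y * (ennreal (h y) * ennreal (letter_fun e y)) *
        nested_integrand n w (Suc i) y t \<partial>Pi\<^sub>M {Suc i..<Suc i + length w} (\<lambda>_. lborel)) =
      indicator {0<..<x} y * (ennreal (h y) * (ennreal (letter_fun e y) * nested_integral n w (Suc i) y))"
    \<comment> \<open>For \<open>y <= 0\<close> the inner integrand vanishes, which supplies the
      lower limit 0.\<close>
    proof (cases "0 < y")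
      case True
      then show ?thesis
        by (subst nn_integral_cmult, measurable) (auto simp: mult.assoc split: split_indicator)
    qed (simp add: nested_integrand_nonpos)
  qed
  finally show ?thesis .
qed

text \<open>Ending in \<open>L1\<close> keeps \<open>L0\<close> from meeting the bare factor x^n,
  where 1/t would not be integrable for \<open>n = 0\<close>. The bound \<open>x < 1\<close> keeps
  the geometric series convergent.\<close>

lemma nested_integral_eq:
  assumes "w = [] \<or> last w = L1" "0 < x" "x < 1"
  shows "nested_integral n w i x = (\<Sum>j. ennreal (word_coeff n w j * x ^ j))"
  using assms
proof (induction w arbitrary: i x)
  case Nil
  have "(\<Sum>j. ennreal (word_coeff n [] j * x ^ j)) = (\<Sum>j\<in>{n}. ennreal (word_coeff n [] j * x ^ j))"
    by (rule suminf_finite) auto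
  also have "\<dots> = ennreal (x ^ n)" by simp
  also have "\<dots> = nested_integral n [] i x"
    using Nil.prems by (simp add: PiM_empty nn_integral_count_space_finite)
  finally show ?case by (rule sym)
next
  case (Cons e w)
  have w: "w = [] \<or> last w = L1" using Cons.prems by (auto split: if_splits)
  \<comment> \<open>The coefficients before integration: the factor \<open>Suc q\<close> cancels the
    division by the index in \<open>word_coeff\<close>.\<close>
  define d where "d q = word_coeff n (e # w) (Suc q) * real (Suc q)" for q
  have d: "0 \<le> d q" for q by (simp add: d_def word_coeff_nonneg)
  have step: "ennreal (letter_fun e y) * nested_integral n w (Suc i) y = (\<Sum>q. ennreal (d q * y ^ q))"
    if y: "0 < y" "y < x" for y
  proof (cases e)
    case L0
    then have "w \<noteq> []" using Cons.prems by auto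
    then show ?thesis
      using letter_L0_power_series[of y w n] y Cons.IH[OF w, of y "Suc i"] Cons.prems L0
      by (simp add: d_def)
  next
    case L1
    then show ?thesis
      using letter_L1_power_series[of y n w] y Cons.IH[OF w, of y "Suc i"] Cons.prems L1
      by (simp add: d_def del: sum.lessThan_Suc)
  qed
  have "nested_integral n (e # w) i x =
      (\<integral>\<^sup>+y. indicator {0<..<x} y * (ennreal (letter_fun e y) * nested_integral n w (Suc i) y) \<partial>lborel)"
    using nn_integral_weighted_nested_Cons[where h = "\<lambda>_. 1" and i = i and n = n and e = e and w = w and x = x] by simp
  also have "\<dots> = (\<integral>\<^sup>+y. indicator {0<..<x} y * (ennreal 1 * (\<Sum>q. ennreal (d q * y ^ q))) \<partial>lborel)"
    using step by (intro nn_integral_cong) (auto split: split_indicator)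
  also have "\<dots> = (\<Sum>q. ennreal (d q * (x ^ Suc q / real (Suc q))))"
    using Cons.prems has_integral_power_Ioo[of x] by (intro nn_integral_power_series d) auto
  also have "\<dots> = (\<Sum>q. ennreal (word_coeff n (e # w) (Suc q) * x ^ Suc q))"
    by (simp add: d_def del: power_Suc of_nat_Suc)
  also have "\<dots> = (\<Sum>j. ennreal (word_coeff n (e # w) j * x ^ j))"
    by (rule suminf_ennreal_shift) (simp add: word_coeff_0)
  finally show ?case .
qed

text \<open>The outermost variable is treated apart because it carries the weight and its upper
  endpoint is 1. The inner integrals have endpoints y < 1, so their power series apply, and the beta
  integrals finish termwise.\<close>

lemma weighted_nested_integral_L0:
  assumes "w \<noteq> []" "last w = L1"
  shows "(\<integral>\<^sup>+t. ennreal ((1 - t 0) ^ m) * nested_integrand n (L0 # w) 0 1 t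
        \<partial>Pi\<^sub>M {..<Suc (length w)} (\<lambda>_. lborel)) =
    (\<Sum>j. ennreal (inverse (real ((j + m) choose m)) * word_coeff n (L0 # w) j))"
proof -
  have "(\<integral>\<^sup>+t. ennreal ((1 - t 0) ^ m) * nested_integrand n (L0 # w) 0 1 t
        \<partial>Pi\<^sub>M {..<Suc (length w)} (\<lambda>_. lborel)) =
      (\<integral>\<^sup>+y. indicator {0<..<1} y * (ennreal ((1 - y) ^ m) *
        (ennreal (letter_fun L0 y) * nested_integral n w (Suc 0) y)) \<partial>lborel)"
    using nn_integral_weighted_nested_Cons[where h = "\<lambda>y. (1 - y) ^ m" and i = 0 and n = n and e = L0 and w = w and x = 1]
    by (simp add: atLeast0LessThan del: nested_integrand.simps)
  also have "\<dots> = (\<integral>\<^sup>+y. indicator {0<..<1} y * (ennreal ((1 - y) ^ m) *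
      (\<Sum>q. ennreal (word_coeff n w (Suc q) * y ^ q))) \<partial>lborel)"
    using assms letter_L0_power_series[where n = n and w = w] nested_integral_eq[where w = w and n = n and i = "Suc 0"]
    by (intro nn_integral_cong) (auto split: split_indicator)
  also have "\<dots> = (\<Sum>q. ennreal (word_coeff n w (Suc q) *
      (1 / (real (Suc q) * real ((Suc q + m) choose m)))))"
    by (intro nn_integral_power_series has_integral_beta_nat) (auto simp: word_coeff_nonneg)
  also have "\<dots> = (\<Sum>q. ennreal (inverse (real ((Suc q + m) choose m)) * word_coeff n (L0 # w) (Suc q)))"
    by (simp add: field_simps del: of_nat_Suc binomial_Suc_Suc)
  also have "\<dots> = (\<Sum>j. ennreal (inverse (real ((j + m) choose m)) * word_coeff n (L0 # w) j))"
    by (rule suminf_ennreal_shift) simp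
  finally show ?thesis .
qed

section \<open>Measurability, positivity and the passage to the Bochner integral\<close>

lemma measurable_sorted_wrt_greater:
  assumes "\<And>g. g \<in> set gs \<Longrightarrow> g \<in> borel_measurable M"
  shows "Measurable.pred M (\<lambda>t. sorted_wrt (>) (map (\<lambda>g. g t :: real) gs))"
  using assms
proof (induction gs)
  case (Cons g gs)
  have [measurable]: "g \<in> borel_measurable M" "Measurable.pred M (\<lambda>t. sorted_wrt (>) (map (\<lambda>g. g t) gs))"
    using Cons by auto
  have [measurable]: "Measurable.pred M (\<lambda>t. \<forall>h\<in>set gs. h t < g t)"
    using Cons.prems by (intro pred_intros_finite) (auto intro!: borel_measurable_less)
  show ?case by simp
qed simp

lemma measurable_component_lborel_pow [measurable]:
  "i < k \<Longrightarrow> (\<lambda>t. t i) \<in> borel_measurable (lborel_pow k)"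
  using measurable_component_singleton[of i "{..<k}" "\<lambda>_. lborel :: real measure"]
  by (simp add: lborel_pow_def)

lemma open_simplex_measurable [measurable]: "open_simplex k \<in> sets (lborel_pow k)"
proof -
  let ?gs = "(\<lambda>_. 1) # map (\<lambda>i t. t i) [0..<k] @ [\<lambda>_. 0]"
  have "Measurable.pred (lborel_pow k) (\<lambda>t. sorted_wrt (>) (map (\<lambda>g. g t :: real) ?gs))"
    by (rule measurable_sorted_wrt_greater) auto
  then show ?thesis
    by (simp add: open_simplex_def pred_def o_def)
qed

lemma measurable_zeta_integrand [measurable]:
  assumes "w \<noteq> []"
  shows "zeta_integrand w m n \<in> borel_measurable (lborel_pow (length w))"
proof -
  have [measurable]: "(\<lambda>t. t 0) \<in> borel_measurable (lborel_pow (length w))"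
    "(\<lambda>t. t (length w - 1)) \<in> borel_measurable (lborel_pow (length w))"
    using assms by (auto intro!: measurable_component_lborel_pow)
  have [measurable]: "(\<lambda>t. \<Prod>i<length w. letter_fun (w ! i) (t i)) \<in> borel_measurable (lborel_pow (length w))"
    by (intro borel_measurable_prod measurable_compose[OF measurable_component_lborel_pow measurable_letter_fun]) auto
  show ?thesis unfolding zeta_integrand_def[abs_def] by measurable
qed

lemma letter_fun_pos: "0 < y \<Longrightarrow> y < 1 \<Longrightarrow> 0 < letter_fun e y"
  by (cases e) auto

lemma open_simplexD:
  assumes "t \<in> open_simplex k" "i < k"
  shows "0 < t i" "t i < 1"
  using assms by (auto simp: open_simplex_def sorted_wrt_append)

lemma zeta_integrand_nonneg:
  assumes "t \<in> open_simplex (length w)" "w \<noteq> []"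
  shows "0 \<le> zeta_integrand w m n t"
  using open_simplexD[OF assms(1)] assms(2) unfolding zeta_integrand_def
  by (intro mult_nonneg_nonneg prod_nonneg zero_le_power) (auto intro!: letter_fun_pos less_imp_le)

text \<open>On the simplex all factors are nonnegative, so \<open>ennreal\<close> respects the
  product; off it both sides vanish.\<close>

lemma ennreal_zeta_integrand:
  assumes "t \<in> space (lborel_pow (length w))" "w \<noteq> []"
  shows "ennreal (indicator (open_simplex (length w)) t * zeta_integrand w m n t) =
    ennreal ((1 - t 0) ^ m) * nested_integrand n w 0 1 t"
proof (cases "t \<in> open_simplex (length w)")
  case True
  note t = open_simplexD[OF this]
  have "sorted_wrt (>) (1 # map t [0..<0 + length w] @ [0])"
    using True by (simp add: open_simplex_def)
  moreover have "last (1 # map t [0..<0 + length w]) = t (length w - 1)"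
    using assms(2) by (simp add: last_map)
  ultimately have "nested_integrand n w 0 1 t =
      (\<Prod>l<length w. ennreal (letter_fun (w ! l) (t l))) * ennreal (t (length w - 1) ^ n)"
    unfolding nested_integrand_eq by simp
  also have "\<dots> = ennreal ((\<Prod>l<length w. letter_fun (w ! l) (t l)) * t (length w - 1) ^ n)"
    using t assms(2)
    by (subst prod_ennreal, use less_imp_le[OF letter_fun_pos] in force,
        subst ennreal_mult) (auto intro!: letter_fun_pos prod_pos less_imp_le)
  finally show ?thesis
    using t[of 0] assms(2) True
    by (simp add: zeta_integrand_def mult.assoc ennreal_mult')
next
  case False
  then have "\<not> sorted_wrt (>) (1 # map t [0..<0 + length w] @ [0])"
    using assms by (simp add: open_simplex_def)
  then have "nested_integrand n w 0 1 t = 0" unfolding nested_integrand_eq by (rule if_not_P)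
  then show ?thesis using False by simp
qed

text \<open>The nonnegative integral is already known as a series in [0, infinity]; summability
  makes it finite, which yields integrability together with the value.\<close>

lemma has_bochner_integral_zeta_integrand:
  fixes n :: nat
  assumes "w \<noteq> []" "last w = L1"
  defines "v \<equiv> L0 # w"
  shows "has_bochner_integral (lborel_pow (length v))
    (\<lambda>t. indicator (open_simplex (length v)) t *\<^sub>R zeta_integrand v m n t)
    (\<Sum>j. inverse (real ((j + m) choose m)) * word_coeff n v j)"
    and "summable (\<lambda>j. inverse (real ((j + m) choose m)) * word_coeff n v j)"
proof -
  let ?g = "\<lambda>j. inverse (real ((j + m) choose m)) * word_coeff n v j"
  have g: "0 \<le> ?g j" for j by (simp add: word_coeff_nonneg)
  show sm: "summable ?g"
  proof (rule summable_comparison_test'[where N = 0])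
    show "summable (word_coeff n v)" unfolding v_def by (rule summable_word_coeff_L0)
    fix j
    \<comment> \<open>The weights are at most 1, so the unweighted coefficients dominate.\<close>
    have "1 \<le> real ((j + m) choose m)" by (simp add: Suc_leI zero_less_binomial)
    then have "inverse (real ((j + m) choose m)) \<le> 1" by (simp add: inverse_le_1_iff)
    then show "norm (?g j) \<le> word_coeff n v j"
      using word_coeff_nonneg[of n v j] by (simp add: abs_mult mult_left_le_one_le)
  qed
  have v: "v \<noteq> []" by (simp add: v_def)
  show "has_bochner_integral (lborel_pow (length v))
    (\<lambda>t. indicator (open_simplex (length v)) t *\<^sub>R zeta_integrand v m n t) (suminf ?g)"
  proof (rule has_bochner_integral_nn_integral)
    show "(\<lambda>t. indicator (open_simplex (length v)) t *\<^sub>R zeta_integrand v m n t)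
        \<in> borel_measurable (lborel_pow (length v))"
      using v by measurable
    show "AE t in lborel_pow (length v). 0 \<le> indicator (open_simplex (length v)) t *\<^sub>R zeta_integrand v m n t"
      using zeta_integrand_nonneg[OF _ v] by (intro AE_I2) (auto split: split_indicator)
    show "0 \<le> suminf ?g" using sm g by (rule suminf_nonneg)
    have "(\<integral>\<^sup>+t. ennreal (indicator (open_simplex (length v)) t *\<^sub>R zeta_integrand v m n t) \<partial>lborel_pow (length v)) =
        (\<integral>\<^sup>+t. ennreal ((1 - t 0) ^ m) * nested_integrand n v 0 1 t \<partial>lborel_pow (length v))"
      using ennreal_zeta_integrand[OF _ v] by (intro nn_integral_cong) simp
    also have "\<dots> = (\<Sum>j. ennreal (?g j))"
      using weighted_nested_integral_L0[OF assms(1,2), of m n]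
      by (simp add: lborel_pow_def v_def del: nested_integrand.simps)
    also have "\<dots> = ennreal (suminf ?g)" using g sm by (rule suminf_ennreal2)
    finally show "(\<integral>\<^sup>+t. ennreal (indicator (open_simplex (length v)) t *\<^sub>R zeta_integrand v m n t)
        \<partial>lborel_pow (length v)) = ennreal (suminf ?g)" .
  qed
qed

section \<open>Admissible words and the final identification\<close>

lemma binary_word_admissible:
  assumes "admissible a" "a \<noteq> []"
  obtains w where "binary_word a = L0 # w" "w \<noteq> []" "last w = L1"
proof -
  \<comment> \<open>As a_1 >= 2, one zero can be split off; \<open>k\<close> = a_1 - 2 zeros remain
    before the first \<open>L1\<close>.\<close>
  obtain k b where a: "a = Suc (Suc k) # b"
    using assms by (cases a) (auto simp: admissible_def numeral_2_eq_2 Suc_le_eq elim!: less_natE)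
  define w where "w = replicate k L0 @ L1 # binary_word b"
  have "last (binary_word c) = L1" if "c \<noteq> []" for c
    using that by (induction c rule: rev_induct) (auto simp: binary_word_def)
  then have "last w = L1"
    unfolding w_def by (cases "b = []") (auto simp: binary_word_def)
  moreover have "binary_word a = L0 # w" by (simp add: a w_def binary_word_def)
  ultimately show ?thesis using that by (auto simp: w_def)
qed

theorem theorem1:
  fixes a :: "nat list" and m n :: nat
  assumes "admissible a" and "a \<noteq> []"
  shows "set_integrable (lborel_pow (length (binary_word a))) (open_simplex (length (binary_word a)))
           (zeta_integrand (binary_word a) m n)
       \<and> zeta_term a m summable_on zeta_indices (length a) n
       \<and> zeta_integral a m n = (\<Sum>\<^sub>\<infinity>ns\<in>zeta_indices (length a) n. zeta_term a m ns)"
proof -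
  obtain w where w: "binary_word a = L0 # w" "w \<noteq> []" "last w = L1"
    using binary_word_admissible[OF assms] by blast
  \<comment> \<open>The common value: termwise integration identifies it with the integral, grouping
    tuples by their head with the nested sum.\<close>
  define S where "S = (\<Sum>j. inverse (real ((j + m) choose m)) * word_coeff n (binary_word a) j)"
  have int: "has_bochner_integral (lborel_pow (length (binary_word a)))
      (\<lambda>t. indicator (open_simplex (length (binary_word a))) t *\<^sub>R zeta_integrand (binary_word a) m n t) S"
    unfolding S_def w(1) by (rule has_bochner_integral_zeta_integrand[OF w(2,3)])
  have "(\<lambda>j. inverse (real ((j + m) choose m)) * word_coeff n (binary_word a) j) sums S"
    unfolding S_def w(1) by (intro summable_sums has_bochner_integral_zeta_integrand[OF w(2,3)])
  then have sum: "(zeta_term a m has_sum S) (zeta_indices (length a) n)"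
    using assms by (intro has_sum_zeta_term) (auto simp: admissible_def)
  show ?thesis
    using int sum
    by (auto simp: set_integrable_def zeta_integral_def set_lebesgue_integral_def Let_def
        has_bochner_integral_iff infsumI intro: has_sum_imp_summable)
qed

end
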